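(* Let $M$ be a real symmetric $d\times d$ matrix, $J$ a constant real negative semidefinite $d\times d$ matrix, and $U:\mathbb{R}^d\to\mathbb{R}$ a cubic polynomial. Let $\bar U:\mathbb{R}^d\times\mathbb{R}^d\to\mathbb{R}$ be a quadratic polarization of $U$ and let $\overline{\nabla}\bar U$ be a polarized discrete gradient for $\bar U$. Let $h>0$ and let $(y_n)_{n\ge 0}$ be a sequence in $\mathbb{R}^d$ satisfying, for all $n\ge 0$, the scheme $$y_{n+2}=\exp(2hJM)\,y_n+2h\,\phi(2hJM)\,J\,\overline{\nabla}\bar U(y_n,y_{n+1},y_{n+2}).$$ Then, with $$\bar H(y_n,y_{n+1})=\tfrac14\left(y_n^TMy_n+y_{n+1}^TMy_{n+1}\right)+\bar U(y_n,y_{n+1}),$$ the scheme preserves the polarized Lyapunov function $\bar H$ in the sense that $$\bar H(y_{n+1},y_{n+2})\le\bar H(y_{n+1},y_n)\qquad\text{for all } n\ge0.$$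
   Context: The scheme is a numerical method with step size $h$ for the system $\dot y=J\nabla H(y)=JMy+J\nabla U(y)$ with $H(y)=\frac12y^TMy+U(y)$. A real square matrix $J$, not necessarily symmetric, is negative semidefinite if $x^TJx\le0$ for all $x\in\mathbb{R}^d$. $\phi$ is the entire function $\phi(z)=\frac{e^z-1}{z}$ (with $\phi(0)=1$), and for a square matrix $V$, $\phi(V)=\sum_{k\ge0}\frac{V^k}{(k+1)!}$. A quadratic polarization of $U$ (in two arguments) is a polynomial function $\bar U(x,y)$, of degree at most two in each of the vector arguments $x,y\in\mathbb{R}^d$, that is consistent with $U$, i.e. $\bar U(x,x)=U(x)$, and invariant under cyclic permutation of its arguments, i.e. $\bar U(x,y)=\bar U(y,x)$. A polarized discrete gradient for $\bar U$ is a map $\overline{\nabla}\bar U:(\mathbb{R}^d)^3\to\mathbb{R}^d$ such that for all $x,y,z\in\mathbb{R}^d$: $$\bar U(y,z)-\bar U(x,y)=\tfrac12(z-x)^T\,\overline{\nabla}\bar U(x,y,z),\qquad \overline{\nabla}\bar U(x,x,x)=\nabla U(x).$$ *)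

theory Defs
  imports "HOL-Analysis.Analysis"
begin

definition negative_semidefinite :: "real^'n^'n \<Rightarrow> bool" where
  "negative_semidefinite J \<longleftrightarrow> (\<forall>x. x \<bullet> (J *v x) \<le> 0)"

(* Powers with respect to the matrix product; the overloaded operations
   times and power on the type vec are not those of the matrix ring. *)
definition matrix_power :: "real^'n^'n \<Rightarrow> nat \<Rightarrow> real^'n^'n" where
  "matrix_power V k = (((**) V) ^^ k) (mat 1)"

(* exp needs the class real_normed_algebra_1, of which real^'n^'n is not an instance.
   Both series below converge absolutely for every V, so suminf is their sum. *)
definition matrix_exp :: "real^'n^'n \<Rightarrow> real^'n^'n" where
  "matrix_exp V = (\<Sum>k. (1 / fact k) *\<^sub>R matrix_power V k)"

definition matrix_phi :: "real^'n^'n \<Rightarrow> real^'n^'n" where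
  "matrix_phi V = (\<Sum>k. (1 / fact (k + 1)) *\<^sub>R matrix_power V k)"

definition multi_indices :: "nat \<Rightarrow> ('n::finite \<Rightarrow> nat) set" where
  "multi_indices m = {\<alpha>. (\<Sum>i\<in>UNIV. \<alpha> i) \<le> m}"

lemma finite_multi_indices: "finite (multi_indices m :: ('n::finite \<Rightarrow> nat) set)"
proof (rule finite_subset)
  show "multi_indices m \<subseteq> (PiE UNIV (\<lambda>_. {..m}) :: ('n \<Rightarrow> nat) set)"
  proof
    fix \<alpha> :: "'n \<Rightarrow> nat"
    assume "\<alpha> \<in> multi_indices m"
    then have "\<alpha> i \<le> m" for i
      using member_le_sum[of i UNIV \<alpha>] by (auto simp: multi_indices_def intro: order_trans)
    then show "\<alpha> \<in> PiE UNIV (\<lambda>_. {..m})" by auto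
  qed
  show "finite (PiE UNIV (\<lambda>_. {..m}) :: ('n \<Rightarrow> nat) set)"
    by (intro finite_PiE) auto
qed

definition monomial_fun :: "('n::finite \<Rightarrow> nat) \<Rightarrow> real^'n \<Rightarrow> real" where
  "monomial_fun \<alpha> x = (\<Prod>i\<in>UNIV. (x $ i) ^ \<alpha> i)"

definition polynomial_fun_degree_le :: "nat \<Rightarrow> (real^'n \<Rightarrow> real) \<Rightarrow> bool" where
  "polynomial_fun_degree_le m f \<longleftrightarrow>
     (\<exists>c. \<forall>x. f x = (\<Sum>\<alpha>\<in>multi_indices m. c \<alpha> * monomial_fun \<alpha> x))"

(* Polynomial functions of the pair (x, y) of total degree at most m in the
   components of x and of total degree at most m in the components of y. *)
definition bipolynomial_fun_degree_le :: "nat \<Rightarrow> (real^'n \<Rightarrow> real^'n \<Rightarrow> real) \<Rightarrow> bool" where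
  "bipolynomial_fun_degree_le m g \<longleftrightarrow>
     (\<exists>c. \<forall>x y. g x y =
        (\<Sum>\<alpha>\<in>multi_indices m. \<Sum>\<beta>\<in>multi_indices m.
           c \<alpha> \<beta> * monomial_fun \<alpha> x * monomial_fun \<beta> y))"

definition quadratic_polarization ::
  "(real^'n \<Rightarrow> real) \<Rightarrow> (real^'n \<Rightarrow> real^'n \<Rightarrow> real) \<Rightarrow> bool" where
  "quadratic_polarization U Ub \<longleftrightarrow>
     bipolynomial_fun_degree_le 2 Ub \<and>
     (\<forall>x. Ub x x = U x) \<and>
     (\<forall>x y. Ub x y = Ub y x)"

definition polarized_discrete_gradient ::
  "(real^'n \<Rightarrow> real) \<Rightarrow> (real^'n \<Rightarrow> real^'n \<Rightarrow> real) \<Rightarrow>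
   (real^'n \<Rightarrow> real^'n \<Rightarrow> real^'n \<Rightarrow> real^'n) \<Rightarrow> bool" where
  "polarized_discrete_gradient U Ub G \<longleftrightarrow>
     (\<forall>x y z. Ub y z - Ub x y = (1/2) * ((z - x) \<bullet> G x y z)) \<and>
     (\<forall>x. GDERIV U x :> G x x x)"

definition polarized_energy ::
  "real^'n^'n \<Rightarrow> (real^'n \<Rightarrow> real^'n \<Rightarrow> real) \<Rightarrow> real^'n \<Rightarrow> real^'n \<Rightarrow> real" where
  "polarized_energy M Ub x y = (1/4) * (x \<bullet> (M *v x) + y \<bullet> (M *v y)) + Ub x y"

end

theory Submission
  imports Defs
begin

text \<open>
  With \<open>g\<close> the discrete gradient frozen at step \<open>n\<close>, the scheme is the exact time-\<open>2h\<close> flow of the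
  affine equation \<open>u' = J (M u + g)\<close> started at \<open>y n\<close>. Along this flow the quadratic function
  \<open>u\<^sup>T M u / 2 + g\<^sup>T u\<close> has derivative \<open>(M u + g)\<^sup>T J (M u + g) \<le> 0\<close>, and by the discrete gradient
  identity its increment over \<open>[0, 2h]\<close> is twice the increment of the polarized energy. Arguing with
  the flow avoids inverting \<open>M\<close>.
\<close>

lemma matrix_power_0 [simp]: "matrix_power V 0 = mat 1"
  by (simp add: matrix_power_def)

lemma matrix_power_Suc: "matrix_power V (Suc k) = V ** matrix_power V k"
  by (simp add: matrix_power_def)

lemma matrix_power_Suc2: "matrix_power V (Suc k) = matrix_power V k ** V"
  by (induction k) (simp_all add: matrix_power_Suc matrix_mul_assoc)

lemma matrix_power_scaleR: "matrix_power (t *\<^sub>R V) k = t ^ k *\<^sub>R matrix_power V k"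
  by (induction k)
    (simp_all add: matrix_power_Suc matrix_scalar_ac mult.commute flip: scalar_matrix_assoc)

text \<open>Multiplication by a fixed matrix is thereby continuous, so it can be moved inside the
  series for \<open>matrix_exp\<close> and \<open>matrix_phi\<close>.\<close>

lemma bounded_bilinear_matrix_matrix_mult:
  "bounded_bilinear ((**) :: real^'n^'m \<Rightarrow> real^'p^'n \<Rightarrow> real^'p^'m)"
  unfolding bilinear_conv_bounded_bilinear[symmetric] bilinear_def
  by (auto intro!: linearI simp: matrix_add_ldistrib matrix_scalar_ac scalar_matrix_assoc)
    (simp add: matrix_matrix_mult_def vec_eq_iff sum.distrib distrib_right)

lemma bounded_bilinear_matrix_vector_mult:
  "bounded_bilinear ((*v) :: real^'n^'m \<Rightarrow> real^'n \<Rightarrow> real^'m)"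
  unfolding bilinear_conv_bounded_bilinear[symmetric] bilinear_def
  by (auto intro!: linearI simp: algebra_simps scaleR_matrix_vector_assoc)

text \<open>The norm here is the Euclidean norm of nested vectors, so the product estimate carries a
  constant and \<open>mat 1\<close> need not have norm 1. A geometric bound still suffices to
  compare both series with the real exponential series.\<close>

lemma norm_matrix_power_le:
  obtains K where "\<And>k. norm (matrix_power (V :: real^'n^'n) k) \<le> norm (mat 1 :: real^'n^'n) * K ^ k"
proof -
  obtain K where K: "0 \<le> K" "\<And>(A :: real^'n^'n) (B :: real^'n^'n). norm (A ** B) \<le> norm A * norm B * K"
    using bounded_bilinear.nonneg_bounded[OF
        bounded_bilinear_matrix_matrix_mult[where 'n='n and 'm='n and 'p='n]] by auto
  have "norm (matrix_power V k) \<le> norm (mat 1 :: real^'n^'n) * (norm V * K) ^ k" for k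
  proof (induction k)
    case (Suc k)
    have "norm (matrix_power V (Suc k)) \<le> norm V * norm (matrix_power V k) * K"
      by (simp add: matrix_power_Suc K)
    also have "\<dots> \<le> norm V * (norm (mat 1 :: real^'n^'n) * (norm V * K) ^ k) * K"
      using Suc K by (intro mult_mono) auto
    finally show ?case by (simp add: mult_ac)
  qed simp
  then show ?thesis by (rule that)
qed

lemma summable_matrix_exp:
  "summable (\<lambda>k. (1 / fact k) *\<^sub>R matrix_power (V :: real^'n^'n) k)"
proof -
  obtain K where K: "\<And>k. norm (matrix_power V k) \<le> norm (mat 1 :: real^'n^'n) * K ^ k"
    using norm_matrix_power_le by blast
  show ?thesis
  proof (rule summable_comparison_test')
    show "summable (\<lambda>k. norm (mat 1 :: real^'n^'n) * (inverse (fact k) * K ^ k))"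
      by (intro summable_mult summable_exp)
    show "norm ((1 / fact k) *\<^sub>R matrix_power V k) \<le> norm (mat 1 :: real^'n^'n) * (inverse (fact k) * K ^ k)"
      for k
      using K[of k] by (simp add: field_simps)
  qed
qed

lemma summable_matrix_phi:
  "summable (\<lambda>k. (1 / fact (k + 1)) *\<^sub>R matrix_power (V :: real^'n^'n) k)"
proof -
  obtain K where K: "\<And>k. norm (matrix_power V k) \<le> norm (mat 1 :: real^'n^'n) * K ^ k"
    using norm_matrix_power_le by blast
  show ?thesis
  proof (rule summable_comparison_test')
    show "summable (\<lambda>k. norm (mat 1 :: real^'n^'n) * (inverse (fact k) * K ^ k))"
      by (intro summable_mult summable_exp)
    \<comment> \<open>Since \<open>fact k \<le> fact (k + 1)\<close>, the majorant of the
      exponential series also works here.\<close>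
    fix k :: nat
    have "norm ((1 / fact (k + 1)) *\<^sub>R matrix_power V k)
        = inverse (fact (k + 1)) * norm (matrix_power V k)"
      by (simp add: divide_inverse)
    also have "\<dots> \<le> inverse (fact k) * (norm (mat 1 :: real^'n^'n) * K ^ k)"
      using K[of k] by (intro mult_mono le_imp_inverse_le fact_mono) auto
    finally show "norm ((1 / fact (k + 1)) *\<^sub>R matrix_power V k)
        \<le> norm (mat 1 :: real^'n^'n) * (inverse (fact k) * K ^ k)"
      by (simp add: mult_ac)
  qed
qed

text \<open>Dropping the constant term of the exponential series leaves one factor \<open>V\<close>
  in every term. Pulling it out on the left serves the differential equation of the flow; pulling it
  out on the right serves to rewrite the scheme.\<close>

lemma matrix_exp_eq_phi:
  fixes V :: "real^'n^'n"
  shows "matrix_exp V = mat 1 + V ** matrix_phi V"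
    and "matrix_exp V = mat 1 + matrix_phi V ** V"
proof -
  interpret bounded_bilinear "(**) :: real^'n^'n \<Rightarrow> real^'n^'n \<Rightarrow> real^'n^'n"
    by (rule bounded_bilinear_matrix_matrix_mult)
  have "matrix_exp V = mat 1 + (\<Sum>k. (1 / fact (k + 1)) *\<^sub>R matrix_power V (Suc k))"
    unfolding matrix_exp_def
    using suminf_split_head[OF summable_matrix_exp[of V]] by (simp add: algebra_simps)
  moreover have "(\<Sum>k. (1 / fact (k + 1)) *\<^sub>R matrix_power V (Suc k)) = V ** matrix_phi V"
    unfolding matrix_phi_def bounded_linear.suminf[OF bounded_linear_right summable_matrix_phi]
    by (simp add: matrix_power_Suc scaleR_right)
  moreover have "(\<Sum>k. (1 / fact (k + 1)) *\<^sub>R matrix_power V (Suc k)) = matrix_phi V ** V"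
    unfolding matrix_phi_def bounded_linear.suminf[OF bounded_linear_left summable_matrix_phi]
    by (simp add: matrix_power_Suc2 scaleR_left)
  ultimately show "matrix_exp V = mat 1 + V ** matrix_phi V"
    and "matrix_exp V = mat 1 + matrix_phi V ** V"
    by simp_all
qed

text \<open>Applying a functional \<open>L\<close> turns the matrix series into a real power series
  in \<open>t\<close>, which may be differentiated term by term.\<close>

lemma has_field_derivative_linear_matrix_phi:
  fixes A :: "real^'n^'n" and L :: "real^'n^'n \<Rightarrow> real"
  assumes "bounded_linear L"
  shows "((\<lambda>t. t * L (matrix_phi (t *\<^sub>R A))) has_field_derivative L (matrix_exp (t *\<^sub>R A))) (at t)"
proof -
  interpret bounded_linear L by fact
  \<comment> \<open>The factor \<open>t\<close> shifts all exponents up by one, so the coefficient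
    at 0 vanishes and the one at \<open>Suc j\<close> involves the \<open>j\<close>-th matrix
    power.\<close>
  define c where "c k = (case k of 0 \<Rightarrow> 0 | Suc j \<Rightarrow> L (matrix_power A j) / fact k)" for k
  have "(\<lambda>k. L ((1 / fact (k + 1)) *\<^sub>R matrix_power (s *\<^sub>R A) k)) sums L (matrix_phi (s *\<^sub>R A))" for s
    unfolding matrix_phi_def
    by (intro sums summable_sums summable_matrix_phi)
  then have "(\<lambda>k. s * L ((1 / fact (k + 1)) *\<^sub>R matrix_power (s *\<^sub>R A) k))
      sums (s * L (matrix_phi (s *\<^sub>R A)))" for s
    by (rule sums_mult)
  then have "(\<lambda>k. c (Suc k) * s ^ Suc k) sums (s * L (matrix_phi (s *\<^sub>R A)))" for s
    by (simp add: c_def matrix_power_scaleR scaleR mult_ac del: fact_Suc)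
  then have c: "(\<lambda>k. c k * s ^ k) sums (s * L (matrix_phi (s *\<^sub>R A)))" for s
    using sums_Suc[of "\<lambda>k. c k * s ^ k"] by (force simp: c_def)
  have "(\<lambda>k. L ((1 / fact k) *\<^sub>R matrix_power (t *\<^sub>R A) k)) sums L (matrix_exp (t *\<^sub>R A))"
    unfolding matrix_exp_def
    by (intro sums summable_sums summable_matrix_exp)
  \<comment> \<open>\<open>diffs c k\<close> is \<open>(k + 1) * c (Suc k)\<close>, and the factor
    \<open>k + 1\<close> reduces \<open>fact (k + 1)\<close> to \<open>fact k\<close>.\<close>
  moreover have "L ((1 / fact k) *\<^sub>R matrix_power (t *\<^sub>R A) k) = diffs c k * t ^ k" for k
    by (simp add: c_def diffs_def matrix_power_scaleR scaleR)
  ultimately have "(\<Sum>k. diffs c k * t ^ k) = L (matrix_exp (t *\<^sub>R A))"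
    by (simp add: sums_iff)
  with termdiffs_strong_converges_everywhere[of c t] c show ?thesis
    by (simp add: sums_iff)
qed

lemma has_vector_derivative_matrix_phi:
  fixes A :: "real^'n^'n" and b :: "real^'n"
  shows "((\<lambda>t. t *\<^sub>R (matrix_phi (t *\<^sub>R A) *v b)) has_vector_derivative
    matrix_exp (t *\<^sub>R A) *v b) (at t)"
proof -
  \<comment> \<open>A vector derivative can be checked componentwise; the component along
    \<open>i\<close> is such a functional of the matrix.\<close>
  have L: "bounded_linear (\<lambda>V :: real^'n^'n. (V *v b) \<bullet> i)" for i
    using bounded_linear_compose[OF bounded_linear_inner_left
        bounded_bilinear.bounded_linear_left[OF bounded_bilinear_matrix_vector_mult]] .
  show ?thesis
    unfolding has_vector_derivative_def
    by (subst has_derivative_componentwise_within)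
      (use has_field_derivative_linear_matrix_phi[OF L] in
        \<open>simp add: has_real_derivative_iff_has_vector_derivative has_vector_derivative_def\<close>)
qed

text \<open>By the right-factored identity, \<open>u t\<close> is the variation of constants formula
  \<open>exp(tA) x + t phi(tA) c\<close>. Collecting both terms under one \<open>matrix_phi\<close>
  gives \<open>u' = exp(tA) b\<close> with \<open>b = A x + c\<close>, and the left-factored
  identity turns this into \<open>A u + c\<close>.\<close>

lemma affine_flow_has_vector_derivative:
  fixes A :: "real^'n^'n" and x c :: "real^'n"
  defines "u \<equiv> \<lambda>t. x + t *\<^sub>R (matrix_phi (t *\<^sub>R A) *v (A *v x + c))"
  shows "(u has_vector_derivative A *v u t + c) (at t)"
proof -
  define b where "b = A *v x + c"
  have "A *v u t + c = b + A *v (t *\<^sub>R (matrix_phi (t *\<^sub>R A) *v b))"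
    by (simp add: u_def b_def matrix_vector_right_distrib)
  also have "A *v (t *\<^sub>R (matrix_phi (t *\<^sub>R A) *v b)) = ((t *\<^sub>R A) ** matrix_phi (t *\<^sub>R A)) *v b"
    by (simp add: matrix_vector_mult_scaleR flip: matrix_vector_mul_assoc scaleR_matrix_vector_assoc)
  also have "b + \<dots> = matrix_exp (t *\<^sub>R A) *v b"
    by (simp add: matrix_exp_eq_phi(1) matrix_vector_mult_add_rdistrib)
  finally show ?thesis
    unfolding u_def b_def[symmetric]
    using has_vector_derivative_add[OF has_vector_derivative_const has_vector_derivative_matrix_phi]
    by simp
qed

lemma affine_flow_energy_decreasing:
  fixes M J :: "real^'n^'n" and x g :: "real^'n"
  assumes M: "transpose M = M" and J: "negative_semidefinite J" and "0 \<le> t"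
  defines "u \<equiv> \<lambda>t. x + t *\<^sub>R (matrix_phi (t *\<^sub>R (J ** M)) *v ((J ** M) *v x + J *v g))"
  shows "(u t \<bullet> (M *v u t)) / 2 + g \<bullet> u t \<le> (x \<bullet> (M *v x)) / 2 + g \<bullet> x"
proof -
  define E where "E t = (u t \<bullet> (M *v u t)) / 2 + g \<bullet> u t" for t
  \<comment> \<open>For symmetric \<open>M\<close>, \<open>r t\<close> is the gradient at
    \<open>u t\<close> of the quadratic function behind \<open>E\<close>, and the flow reads
    \<open>u' = J r\<close>.\<close>
  define r where "r t = M *v u t + g" for t
  have u: "(u has_vector_derivative J *v r t) (at t)" for t
    using affine_flow_has_vector_derivative[of x "J ** M" "J *v g" t]
    by (simp add: u_def r_def matrix_vector_right_distrib matrix_vector_mul_assoc)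
  have Mu: "((\<lambda>t. M *v u t) has_vector_derivative M *v (J *v r t)) (at t)" for t
    by (intro bounded_linear.has_vector_derivative[OF _ u] matrix_vector_mul_bounded_linear)
  have "(E has_vector_derivative r t \<bullet> (J *v r t)) (at t)" for t
  proof -
    \<comment> \<open>Symmetry of \<open>M\<close> makes the two product rule terms equal, which
      cancels the factor 1/2; adding the \<open>g\<close> term completes \<open>M u\<close> to
      \<open>r\<close>.\<close>
    have sym: "u t \<bullet> (M *v v) = (M *v u t) \<bullet> v" for v
      using dot_lmul_matrix[of "u t" M v] vector_transpose_matrix[of "u t" M] M by simp
    have "((\<lambda>t. (u t \<bullet> (M *v u t)) / 2 + g \<bullet> u t) has_vector_derivative
        (u t \<bullet> (M *v (J *v r t)) + (J *v r t) \<bullet> (M *v u t)) / 2 + g \<bullet> (J *v r t)) (at t)"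
      by (intro has_vector_derivative_add has_vector_derivative_divide
          bounded_bilinear.has_vector_derivative[OF bounded_bilinear_inner u Mu]
          bounded_linear.has_vector_derivative[OF bounded_linear_inner_right u])
    moreover have "(u t \<bullet> (M *v (J *v r t)) + (J *v r t) \<bullet> (M *v u t)) / 2 + g \<bullet> (J *v r t)
        = r t \<bullet> (J *v r t)"
      unfolding sym inner_commute[of "J *v r t"] by (simp add: r_def inner_add_left)
    ultimately show ?thesis by (simp only: E_def[abs_def])
  qed
  then have "\<exists>d. (E has_real_derivative d) (at s) \<and> d \<le> 0" for s
    using J unfolding has_real_derivative_iff_has_vector_derivative negative_semidefinite_def
    by blast
  then have "E t \<le> E 0"
    using \<open>0 \<le> t\<close> by (rule DERIV_nonpos_imp_nonincreasing[rotated])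
  then show ?thesis by (simp add: E_def u_def)
qed

theorem theorem2:
  fixes M J :: "real^'n^'n"
    and U :: "real^'n \<Rightarrow> real"
    and Ub :: "real^'n \<Rightarrow> real^'n \<Rightarrow> real"
    and G :: "real^'n \<Rightarrow> real^'n \<Rightarrow> real^'n \<Rightarrow> real^'n"
    and h :: real
    and y :: "nat \<Rightarrow> real^'n"
  assumes "transpose M = M"
    and "negative_semidefinite J"
    and "polynomial_fun_degree_le 3 U"
    and "quadratic_polarization U Ub"
    and "polarized_discrete_gradient U Ub G"
    and "h > 0"
    and "\<And>n. y (n + 2) =
           matrix_exp ((2 * h) *\<^sub>R (J ** M)) *v y n +
           (2 * h) *\<^sub>R (matrix_phi ((2 * h) *\<^sub>R (J ** M)) *v
             (J *v G (y n) (y (n + 1)) (y (n + 2))))"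
  shows "\<forall>n. polarized_energy M Ub (y (n + 1)) (y (n + 2))
             \<le> polarized_energy M Ub (y (n + 1)) (y n)"
proof
  fix n
  let ?A = "J ** M" and ?x = "y n" and ?z = "y (n + 2)"
  let ?g = "G (y n) (y (n + 1)) (y (n + 2))" and ?V = "(2 * h) *\<^sub>R (J ** M)"
  \<comment> \<open>This puts the scheme in the form of the flow started at \<open>?x\<close> and
    evaluated at time \<open>2 * h\<close>.\<close>
  have "(matrix_phi ?V ** ?V) *v ?x = (2 * h) *\<^sub>R (matrix_phi ?V *v (?A *v ?x))"
    by (simp add: matrix_vector_mult_scaleR flip: matrix_vector_mul_assoc scaleR_matrix_vector_assoc)
  then have z: "?z = ?x + (2 * h) *\<^sub>R (matrix_phi ?V *v (?A *v ?x + J *v ?g))"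
    using assms(7)[of n]
    by (simp add: matrix_exp_eq_phi(2) matrix_vector_mult_add_rdistrib matrix_vector_right_distrib
        scaleR_add_right add.assoc)
  have "(?z \<bullet> (M *v ?z)) / 2 + ?g \<bullet> ?z \<le> (?x \<bullet> (M *v ?x)) / 2 + ?g \<bullet> ?x"
    using affine_flow_energy_decreasing[OF assms(1,2), of "2 * h" ?x ?g] \<open>h > 0\<close>
    unfolding z[symmetric] by simp
  \<comment> \<open>Half the flow inequality has the weights 1/4 of the polarized energy, and its
    linear part is exactly this increment of \<open>Ub\<close>. The quadratic term in
    \<open>y (n + 1)\<close> is common to both energies.\<close>
  moreover have "Ub (y (n + 1)) ?z - Ub ?x (y (n + 1)) = (1/2) * (?g \<bullet> ?z - ?g \<bullet> ?x)"
    using assms(5) by (simp add: polarized_discrete_gradient_def inner_diff_left inner_commute)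
  moreover have "Ub ?x (y (n + 1)) = Ub (y (n + 1)) ?x"
    using assms(4) by (simp add: quadratic_polarization_def)
  ultimately show "polarized_energy M Ub (y (n + 1)) ?z \<le> polarized_energy M Ub (y (n + 1)) ?x"
    unfolding polarized_energy_def by argo
qed

end
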